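(* There holds $$\sup_{\substack{(v_{hp},\boldsymbol q_{hp})\in V_{hp}\times Q_{hp}\\ \|(v_{hp},\boldsymbol q_{hp})\|\ne0}}\frac{(\boldsymbol\mu_{hp},\boldsymbol q_{hp})_{0,\Omega}}{\|(v_{hp},\boldsymbol q_{hp})\|}=\|\boldsymbol\mu_{hp}\|_{0,\Omega}\qquad\forall\,\boldsymbol\mu_{hp}\in Q_{hp}.$$
   Context: Let $d\in\{2,3\}$ and let $\Omega\subset\mathbb R^d$ be a bounded polygonal (polyhedral) domain with Lipschitz boundary $\Gamma$, $\Gamma_D\subseteq\Gamma$ a part of positive surface measure. $\mathbb S_{d,0}$ is the space of symmetric trace-free real $d\times d$ matrices. $(\cdot,\cdot)_{0,\Omega}$ and $\|\cdot\|_{0,\Omega}$ are the $L^2(\Omega)$ inner product and norm (scalar, vector or matrix valued, using the Frobenius inner product for matrices). $V:=\{v\in H^1(\Omega,\mathbb R^d): v|_{\Gamma_D}=0\}$ with norm $\|v\|_{1,\Omega}:=(\|v\|_{0,\Omega}^2+\|\boldsymbol\varepsilon(v)\|_{0,\Omega}^2)^{1/2}$, $\boldsymbol\varepsilon(v):=\frac12(\nabla v+(\nabla v)^\top)$; $Q:=L^2(\Omega,\mathbb S_{d,0})$; $\|(v,\boldsymbol q)\|^2:=\|v\|_{1,\Omega}^2+\|\boldsymbol q\|_{0,\Omega}^2$. $\mathcal T_h$ is a locally quasi-uniform finite element mesh of $\Omega$ of quadrilaterals ($d=2$) or hexahedra ($d=3$); $\widehat T:=[-1,1]^d$ and $F_T:\widehat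 T\to T$ is the bi-/tri-linear bijective mapping of $T\in\mathcal T_h$. Each $T$ carries a polynomial degree $p_T\ge1$ (comparable on neighboring elements). $\mathbb P_k(\widehat T)$ denotes the tensor-product polynomials of degree at most $k$ in each variable. It is assumed that $\det\nabla F_T\in\mathbb P_1(\widehat T)$ whenever $p_T\ge2$. $$V_{hp}:=\{v_{hp}\in V: v_{hp}|_T\circ F_T\in(\mathbb P_{p_T}(\widehat T))^d\ \forall T\in\mathcal T_h\},\qquad Q_{hp}:=\{\boldsymbol q_{hp}\in Q:\boldsymbol q_{hp}|_T\circ F_T\in(\mathbb P_{p_T-1}(\widehat T))^{d\times d}\ \forall T\in\mathcal T_h\}.$$ *)

theory Defs
  imports "HOL-Analysis.Analysis"
begin

section \<open>\<open>L\<^sup>2\<close> spaces\<close>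

text \<open>Elements are square-integrable functions, not equivalence classes; all notions below
  are invariant under modification on null sets.  On matrices \<open>real ^ 'n ^ 'n\<close> the
  inner product is the Frobenius inner product.\<close>

definition L2 :: "'a measure \<Rightarrow> ('a \<Rightarrow> 'b::euclidean_space) set" where
  "L2 M = {f \<in> borel_measurable M. integrable M (\<lambda>x. (norm (f x))\<^sup>2)}"

definition l2_inner :: "'a measure \<Rightarrow> ('a \<Rightarrow> 'b::euclidean_space) \<Rightarrow> ('a \<Rightarrow> 'b) \<Rightarrow> real" where
  "l2_inner M f g = (\<integral>x. f x \<bullet> g x \<partial>M)"

definition l2_norm :: "'a measure \<Rightarrow> ('a \<Rightarrow> 'b::euclidean_space) \<Rightarrow> real" where
  "l2_norm M f = sqrt (l2_inner M f f)"


section \<open>Polyhedral Lipschitz domains and the surface measure of their boundary\<close>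

definition polyhedral_domain :: "(real ^ 'n) set \<Rightarrow> bool" where
  "polyhedral_domain \<Omega> \<longleftrightarrow> open \<Omega> \<and> connected \<Omega> \<and> bounded \<Omega> \<and> \<Omega> \<noteq> {} \<and>
     (\<exists>\<F>. finite \<F> \<and> (\<forall>P\<in>\<F>. polytope P \<and> aff_dim P = int CARD('n) - 1) \<and> frontier \<Omega> = \<Union>\<F>)"

text \<open>Near each boundary point the set lies strictly below the graph of a Lipschitz function
  over a hyperplane.\<close>

definition lipschitz_boundary :: "'a::euclidean_space set \<Rightarrow> bool" where
  "lipschitz_boundary \<Omega> \<longleftrightarrow> (\<forall>x\<in>frontier \<Omega>. \<exists>U e L \<phi>. open U \<and> x \<in> U \<and> norm e = 1 \<and>
     L-lipschitz_on {y. y \<bullet> e = 0} \<phi> \<and>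
     \<Omega> \<inter> U = {y \<in> U. y \<bullet> e < \<phi> (y - (y \<bullet> e) *\<^sub>R e)})"

text \<open>\<open>k\<close>-dimensional Hausdorff measure for \<open>k \<ge> 1\<close>, normalised to agree with
  \<open>k\<close>-dimensional volume.  (For \<open>k = 0\<close> empty covering sets would be counted, since
  \<open>0 ^ 0 = 1\<close>.)  The measure is the restriction of the outer measure to its
  Caratheodory-measurable sets, hence complete.\<close>

definition hausdorff_outer :: "nat \<Rightarrow> 'a::metric_space set \<Rightarrow> ennreal" where
  "hausdorff_outer k A = ennreal (unit_ball_vol (real k) / 2 ^ k) *
     (SUP \<delta>\<in>{0::real<..}.
        INF U\<in>{U :: nat \<Rightarrow> 'a set. A \<subseteq> (\<Union>i. U i) \<and> (\<forall>i. bounded (U i) \<and> diameter (U i) \<le> \<delta>)}.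
          \<Sum>i. ennreal (diameter (U i) ^ k))"

definition hausdorff_measure :: "nat \<Rightarrow> 'a::metric_space measure" where
  "hausdorff_measure k =
     measure_of UNIV (lambda_system UNIV UNIV (hausdorff_outer k)) (hausdorff_outer k)"

definition surface_measure :: "(real ^ 'n) set \<Rightarrow> (real ^ 'n) measure" where
  "surface_measure \<Omega> = restrict_space (hausdorff_measure (CARD('n) - 1)) (frontier \<Omega>)"


section \<open>Sobolev space \<open>H\<^sup>1\<close> and traces\<close>

definition partial_deriv :: "'n \<Rightarrow> (real ^ 'n \<Rightarrow> 'b::real_normed_vector) \<Rightarrow> real ^ 'n \<Rightarrow> 'b" where
  "partial_deriv j f x = frechet_derivative f (at x) (axis j 1)"

primrec Ck :: "nat \<Rightarrow> (real ^ 'n \<Rightarrow> 'b::real_normed_vector) \<Rightarrow> bool" where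
  "Ck 0 f \<longleftrightarrow> continuous_on UNIV f"
| "Ck (Suc k) f \<longleftrightarrow> (\<forall>x. f differentiable (at x)) \<and> (\<forall>j. Ck k (partial_deriv j f))"

definition smooth :: "(real ^ 'n \<Rightarrow> 'b::real_normed_vector) \<Rightarrow> bool" where
  "smooth f \<longleftrightarrow> (\<forall>k. Ck k f)"

definition test_function :: "(real ^ 'n) set \<Rightarrow> (real ^ 'n \<Rightarrow> real) \<Rightarrow> bool" where
  "test_function \<Omega> \<phi> \<longleftrightarrow> smooth \<phi> \<and>
     compact (closure {x. \<phi> x \<noteq> 0}) \<and> closure {x. \<phi> x \<noteq> 0} \<subseteq> \<Omega>"

text \<open>Row \<open>i\<close>, column \<open>j\<close> of the gradient is the \<open>j\<close>-th weak derivative of the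
  \<open>i\<close>-th component.\<close>

definition is_weak_grad ::
    "(real ^ 'n) set \<Rightarrow> (real ^ 'n \<Rightarrow> real ^ 'n) \<Rightarrow> (real ^ 'n \<Rightarrow> real ^ 'n ^ 'n) \<Rightarrow> bool" where
  "is_weak_grad \<Omega> v G \<longleftrightarrow> (\<forall>\<phi>. test_function \<Omega> \<phi> \<longrightarrow> (\<forall>i j.
     (\<integral>x. v x $ i * partial_deriv j \<phi> x \<partial>lebesgue_on \<Omega>) =
     - (\<integral>x. G x $ i $ j * \<phi> x \<partial>lebesgue_on \<Omega>)))"

definition H1 :: "(real ^ 'n) set \<Rightarrow> (real ^ 'n \<Rightarrow> real ^ 'n) set" where
  "H1 \<Omega> = {v \<in> L2 (lebesgue_on \<Omega>). \<exists>G \<in> L2 (lebesgue_on \<Omega>). is_weak_grad \<Omega> v G}"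

text \<open>The weak gradient is unique up to null sets.\<close>

definition weak_grad :: "(real ^ 'n) set \<Rightarrow> (real ^ 'n \<Rightarrow> real ^ 'n) \<Rightarrow> real ^ 'n \<Rightarrow> real ^ 'n ^ 'n" where
  "weak_grad \<Omega> v = (SOME G. G \<in> L2 (lebesgue_on \<Omega>) \<and> is_weak_grad \<Omega> v G)"

definition strain :: "(real ^ 'n) set \<Rightarrow> (real ^ 'n \<Rightarrow> real ^ 'n) \<Rightarrow> real ^ 'n \<Rightarrow> real ^ 'n ^ 'n" where
  "strain \<Omega> v x = (1 / 2) *\<^sub>R (weak_grad \<Omega> v x + transpose (weak_grad \<Omega> v x))"

definition H1_norm :: "(real ^ 'n) set \<Rightarrow> (real ^ 'n \<Rightarrow> real ^ 'n) \<Rightarrow> real" where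
  "H1_norm \<Omega> v =
     sqrt ((l2_norm (lebesgue_on \<Omega>) v)\<^sup>2 + (l2_norm (lebesgue_on \<Omega>) (weak_grad \<Omega> v))\<^sup>2)"

text \<open>The trace operator is the continuous extension to \<open>H\<^sup>1\<close> of the restriction
  of smooth functions to the boundary, with values in \<open>L\<^sup>2\<close> of the boundary.\<close>

definition has_trace ::
    "(real ^ 'n) set \<Rightarrow> (real ^ 'n \<Rightarrow> real ^ 'n) \<Rightarrow> (real ^ 'n \<Rightarrow> real ^ 'n) \<Rightarrow> bool" where
  "has_trace \<Omega> v g \<longleftrightarrow> v \<in> H1 \<Omega> \<and> g \<in> L2 (surface_measure \<Omega>) \<and>
     (\<exists>\<phi> :: nat \<Rightarrow> real ^ 'n \<Rightarrow> real ^ 'n. (\<forall>n. smooth (\<phi> n)) \<and>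
        (\<lambda>n. H1_norm \<Omega> (\<lambda>x. \<phi> n x - v x)) \<longlonglongrightarrow> 0 \<and>
        (\<lambda>n. l2_norm (surface_measure \<Omega>) (\<lambda>x. \<phi> n x - g x)) \<longlonglongrightarrow> 0)"


section \<open>The spaces \<open>V\<close> and \<open>Q\<close>\<close>

definition V_space :: "(real ^ 'n) set \<Rightarrow> (real ^ 'n) set \<Rightarrow> (real ^ 'n \<Rightarrow> real ^ 'n) set" where
  "V_space \<Omega> \<Gamma>\<^sub>D = {v \<in> H1 \<Omega>. \<exists>g. has_trace \<Omega> v g \<and>
     (AE x in surface_measure \<Omega>. x \<in> \<Gamma>\<^sub>D \<longrightarrow> g x = 0)}"

definition sym_tracefree :: "(real ^ 'n ^ 'n) set" where
  "sym_tracefree = {A. transpose A = A \<and> trace A = 0}"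

definition Q_space :: "(real ^ 'n) set \<Rightarrow> (real ^ 'n \<Rightarrow> real ^ 'n ^ 'n) set" where
  "Q_space \<Omega> = {q \<in> L2 (lebesgue_on \<Omega>). AE x in lebesgue_on \<Omega>. q x \<in> sym_tracefree}"

definition V_norm :: "(real ^ 'n) set \<Rightarrow> (real ^ 'n \<Rightarrow> real ^ 'n) \<Rightarrow> real" where
  "V_norm \<Omega> v =
     sqrt ((l2_norm (lebesgue_on \<Omega>) v)\<^sup>2 + (l2_norm (lebesgue_on \<Omega>) (strain \<Omega> v))\<^sup>2)"

definition VQ_norm ::
    "(real ^ 'n) set \<Rightarrow> (real ^ 'n \<Rightarrow> real ^ 'n) \<times> (real ^ 'n \<Rightarrow> real ^ 'n ^ 'n) \<Rightarrow> real" where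
  "VQ_norm \<Omega> = (\<lambda>(v, q). sqrt ((V_norm \<Omega> v)\<^sup>2 + (l2_norm (lebesgue_on \<Omega>) q)\<^sup>2))"


section \<open>Meshes and \<open>hp\<close> finite element spaces\<close>

abbreviation ref_cube :: "(real ^ 'n) set" where
  "ref_cube \<equiv> cbox (- 1) 1"

definition tensor_poly :: "nat \<Rightarrow> (real ^ 'n \<Rightarrow> real) set" where
  "tensor_poly k = {f. \<exists>c :: ('n \<Rightarrow> nat) \<Rightarrow> real.
     \<forall>x. f x = (\<Sum>\<alpha> | \<forall>i. \<alpha> i \<le> k. c \<alpha> * (\<Prod>i\<in>UNIV. x $ i ^ \<alpha> i))}"

text \<open>Each element is the bijective image of the reference cube under a map that is affine in
  each variable separately.  Hanging nodes are permitted.\<close>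

definition fe_mesh ::
    "(real ^ 'n) set \<Rightarrow> (real ^ 'n) set set \<Rightarrow> ((real ^ 'n) set \<Rightarrow> real ^ 'n \<Rightarrow> real ^ 'n) \<Rightarrow> bool" where
  "fe_mesh \<Omega> \<T> F \<longleftrightarrow> finite \<T> \<and> \<Union>\<T> = closure \<Omega> \<and>
     (\<forall>T\<in>\<T>. \<forall>T'\<in>\<T>. T \<noteq> T' \<longrightarrow> interior T \<inter> interior T' = {}) \<and>
     (\<forall>T\<in>\<T>. (\<forall>i. (\<lambda>x. F T x $ i) \<in> tensor_poly 1) \<and> bij_betw (F T) ref_cube T)"

definition neighbours :: "'a set \<Rightarrow> 'a set \<Rightarrow> bool" where
  "neighbours T T' \<longleftrightarrow> T \<inter> T' \<noteq> {}"

definition locally_quasi_uniform :: "real \<Rightarrow> 'a::metric_space set set \<Rightarrow> bool" where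
  "locally_quasi_uniform \<kappa> \<T> \<longleftrightarrow>
     (\<forall>T\<in>\<T>. \<forall>T'\<in>\<T>. neighbours T T' \<longrightarrow> diameter T \<le> \<kappa> * diameter T')"

definition comparable_degrees :: "real \<Rightarrow> 'a set set \<Rightarrow> ('a set \<Rightarrow> nat) \<Rightarrow> bool" where
  "comparable_degrees \<kappa> \<T> p \<longleftrightarrow>
     (\<forall>T\<in>\<T>. \<forall>T'\<in>\<T>. neighbours T T' \<longrightarrow> real (p T) \<le> \<kappa> * real (p T'))"

definition jacobian_det :: "(real ^ 'n \<Rightarrow> real ^ 'n) \<Rightarrow> real ^ 'n \<Rightarrow> real" where
  "jacobian_det f x = det (matrix (frechet_derivative f (at x)))"

text \<open>The polynomial condition is imposed almost everywhere on each element: members of \<open>Q_hp\<close>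
  may be discontinuous, and elements overlap in their boundaries.\<close>

definition V_hp ::
    "(real ^ 'n) set \<Rightarrow> (real ^ 'n) set \<Rightarrow> (real ^ 'n) set set \<Rightarrow>
     ((real ^ 'n) set \<Rightarrow> real ^ 'n \<Rightarrow> real ^ 'n) \<Rightarrow> ((real ^ 'n) set \<Rightarrow> nat) \<Rightarrow>
     (real ^ 'n \<Rightarrow> real ^ 'n) set" where
  "V_hp \<Omega> \<Gamma>\<^sub>D \<T> F p = {v \<in> V_space \<Omega> \<Gamma>\<^sub>D. \<forall>T\<in>\<T>. \<exists>P :: real ^ 'n \<Rightarrow> real ^ 'n.
     (\<forall>i. (\<lambda>x. P x $ i) \<in> tensor_poly (p T)) \<and>
     (AE x in lebesgue_on T. v x = P (inv_into ref_cube (F T) x))}"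

definition Q_hp ::
    "(real ^ 'n) set \<Rightarrow> (real ^ 'n) set set \<Rightarrow>
     ((real ^ 'n) set \<Rightarrow> real ^ 'n \<Rightarrow> real ^ 'n) \<Rightarrow> ((real ^ 'n) set \<Rightarrow> nat) \<Rightarrow>
     (real ^ 'n \<Rightarrow> real ^ 'n ^ 'n) set" where
  "Q_hp \<Omega> \<T> F p = {q \<in> Q_space \<Omega>. \<forall>T\<in>\<T>. \<exists>P :: real ^ 'n \<Rightarrow> real ^ 'n ^ 'n.
     (\<forall>i j. (\<lambda>x. P x $ i $ j) \<in> tensor_poly (p T - 1)) \<and>
     (AE x in lebesgue_on T. q x = P (inv_into ref_cube (F T) x))}"

end

theory Submission
  imports Defs "HOL-Real_Asymp.Real_Asymp"
begin

text \<open>The numerator does not see \<open>v\<close>, and the norm of \<open>(v, q)\<close> dominates that of \<open>q\<close>.  So the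
  Cauchy-Schwarz inequality bounds every quotient by \<open>\<parallel>\<mu>\<parallel>\<close> (\<open>l2_Cauchy_Schwarz\<close>), and the bound is
  attained at \<open>(0, \<mu>)\<close>.  If \<open>\<mu>\<close> vanishes almost everywhere then \<open>(0, \<mu>)\<close> is excluded from
  the supremum; \<open>(0, C)\<close> with a constant nonzero symmetric trace-free matrix \<open>C\<close>, which exists as
  soon as \<open>d \<ge> 2\<close>, then gives the value \<open>0\<close> and keeps the index set nonempty.

  The substance lies in \<open>\<parallel>(0, q)\<parallel> = \<parallel>q\<parallel>\<close> and in the zero trace of the zero function.  The
  norm of \<open>V\<close> and the definition of the trace both use the weak gradient, which is an arbitrary
  choice among all weak gradients, so every weak gradient of \<open>0\<close> has to vanish almost everywhere
  (\<open>weak_grad_0\<close>).  This is the fundamental lemma of the calculus of variations: an integrable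
  \<open>f\<close> orthogonal to all test functions on \<open>\<Omega>\<close> is zero almost everywhere.  It is proved with
  test functions that are products of one-dimensional factors \<open>exp (- 1 / t)\<close>; they converge
  boundedly to the indicators of boxes in \<open>\<Omega>\<close>, so \<open>f\<close> has integral zero over each such
  box, hence over each Borel subset of a box in \<open>\<Omega>\<close>, because the boxes form a generator of the
  Borel sets that is stable under intersection.\<close>

section \<open>Calculus of \<open>k\<close> times continuously differentiable functions\<close>

lemma partial_deriv_eq: "(f has_derivative f') (at x) \<Longrightarrow> partial_deriv j f x = f' (axis j 1)"
  unfolding partial_deriv_def by (metis frechet_derivative_at)

lemma Ck_const: "Ck k (\<lambda>_ :: real ^ 'n. c)"
proof (induction k arbitrary: c)
  case (Suc k)
  have "partial_deriv j (\<lambda>_ :: real ^ 'n. c) = (\<lambda>_. 0)" for j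
    by (rule ext) (simp add: partial_deriv_eq[OF has_derivative_const])
  with Suc show ?case by simp
qed simp

lemma Ck_SucD: "Ck (Suc k) f \<Longrightarrow> Ck k f"
proof (induction k arbitrary: f)
  case 0
  then show ?case
    by (auto intro!: differentiable_imp_continuous_on simp: differentiable_on_def)
next
  case (Suc k)
  have "Ck (Suc k) (partial_deriv j f)" for j
    using Suc.prems unfolding Ck.simps(2)[of "Suc k"] by blast
  then have "Ck k (partial_deriv j f)" for j
    by (rule Suc.IH)
  with Suc.prems show ?case by simp
qed

lemma smooth_continuous: "smooth f \<Longrightarrow> continuous_on UNIV f"
  unfolding smooth_def by (metis Ck.simps(1))

lemma Ck_add: "Ck k f \<Longrightarrow> Ck k g \<Longrightarrow> Ck k (\<lambda>x. f x + g x)"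
proof (induction k arbitrary: f g)
  case 0
  then show ?case by (auto intro: continuous_intros)
next
  case (Suc k)
  have "partial_deriv j (\<lambda>x. f x + g x) = (\<lambda>x. partial_deriv j f x + partial_deriv j g x)" for j
  proof
    fix x
    have "(f has_derivative frechet_derivative f (at x)) (at x)"
      "(g has_derivative frechet_derivative g (at x)) (at x)"
      using Suc.prems by (auto simp: frechet_derivative_works)
    from has_derivative_add[OF this]
    show "partial_deriv j (\<lambda>x. f x + g x) x = partial_deriv j f x + partial_deriv j g x"
      by (simp add: partial_deriv_eq) (simp add: partial_deriv_def)
  qed
  with Suc show ?case by (auto intro: differentiable_add)
qed

lemma Ck_mult:
  fixes f g :: "real ^ 'n \<Rightarrow> real"
  shows "Ck k f \<Longrightarrow> Ck k g \<Longrightarrow> Ck k (\<lambda>x. f x * g x)"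
proof (induction k arbitrary: f g)
  case 0
  then show ?case by (auto intro: continuous_intros)
next
  case (Suc k)
  have "partial_deriv j (\<lambda>x. f x * g x) = (\<lambda>x. f x * partial_deriv j g x + partial_deriv j f x * g x)" for j
  proof
    fix x
    have "(f has_derivative frechet_derivative f (at x)) (at x)"
      "(g has_derivative frechet_derivative g (at x)) (at x)"
      using Suc.prems by (auto simp: frechet_derivative_works)
    from has_derivative_mult[OF this]
    show "partial_deriv j (\<lambda>x. f x * g x) x = f x * partial_deriv j g x + partial_deriv j f x * g x"
      by (simp add: partial_deriv_eq) (simp add: partial_deriv_def)
  qed
  moreover have "Ck k f" "Ck k g"
    using Suc.prems Ck_SucD by blast+
  ultimately show ?case
    using Suc by (auto intro!: Ck_add differentiable_mult)
qed

lemma Ck_prod: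
  fixes f :: "'i \<Rightarrow> real ^ 'n \<Rightarrow> real"
  assumes "\<And>i. i \<in> I \<Longrightarrow> Ck k (f i)"
  shows "Ck k (\<lambda>x. \<Prod>i\<in>I. f i x)"
  using assms by (induction I rule: infinite_finite_induct) (auto intro: Ck_const Ck_mult)

section \<open>Smooth approximation of the indicator of a box\<close>

text \<open>The case \<open>m = 0\<close> is the classical smooth function that is flat at the origin.  The
  powers of \<open>t\<close> in the denominator make the family closed, up to linear combinations, under
  differentiation; smoothness of all its members is then a single induction.\<close>

definition flat :: "nat \<Rightarrow> real \<Rightarrow> real" where
  "flat m t = (if t \<le> 0 then 0 else exp (- (1 / t)) / t ^ m)"

text \<open>With \<open>s = 1 / t\<close> this is the statement that \<open>s ^ m / exp s\<close> tends to zero.\<close>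

lemma flat_tendsto_0: "(flat m \<longlongrightarrow> 0) (at 0)"
proof -
  have "((\<lambda>t. inverse t ^ m / exp (inverse t)) \<longlongrightarrow> 0) (at_right (0::real))"
    by (rule filterlim_compose[OF tendsto_power_div_exp_0 filterlim_inverse_at_top_right])
  then have "(flat m \<longlongrightarrow> 0) (at_right 0)"
    by (rule Lim_transform_eventually)
      (auto simp: eventually_at_filter flat_def exp_minus field_simps)
  moreover have "(flat m \<longlongrightarrow> 0) (at_left 0)"
    by (rule Lim_transform_eventually[OF tendsto_const])
      (auto simp: eventually_at_filter flat_def)
  ultimately show ?thesis
    by (simp add: filterlim_at_split)
qed

lemma flat_deriv:
  "(flat m has_real_derivative flat (m + 2) t - m * flat (m + 1) t) (at t)"
proof -
  consider "t < 0" | "t = 0" | "t > 0" by linarith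
  then show ?thesis
  proof cases
    case 1
    have "((\<lambda>_. 0) has_real_derivative 0) (at t)" by simp
    then have "(flat m has_real_derivative 0) (at t)"
      by (rule has_field_derivative_transform_within_open[of _ _ _ "{..<0}"])
         (use 1 in \<open>auto simp: flat_def\<close>)
    then show ?thesis using 1 by (simp add: flat_def)
  next
    case 2
    \<comment> \<open>the difference quotient of \<open>flat m\<close> at the origin is \<open>flat (Suc m)\<close>\<close>
    have "((\<lambda>h. (flat m (0 + h) - flat m 0) / h) \<longlongrightarrow> 0) (at 0)"
      by (rule Lim_transform_eventually[OF flat_tendsto_0[of "Suc m"]])
         (auto simp: eventually_at_filter flat_def)
    then show ?thesis using 2 by (simp add: DERIV_def flat_def)
  next
    case 3
    have "((\<lambda>t. exp (- (1 / t)) / t ^ m) has_real_derivative flat (m + 2) t - m * flat (m + 1) t) (at t)"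
    proof -
      have "m = 0 \<or> t ^ m = t * t ^ (m - Suc 0)"
        by (cases m) simp_all
      then have "exp (- (1 / t)) * (1 / t\<^sup>2) / t ^ m - exp (- (1 / t)) * (real m * t ^ (m - Suc 0)) / (t ^ m * t ^ m)
          = flat (m + 2) t - m * flat (m + 1) t"
        using 3 by (simp add: flat_def field_simps power2_eq_square)
      moreover have "((\<lambda>t. exp (- (1 / t)) / t ^ m) has_real_derivative
          exp (- (1 / t)) * (1 / t\<^sup>2) / t ^ m - exp (- (1 / t)) * (real m * t ^ (m - Suc 0)) / (t ^ m * t ^ m)) (at t)"
        using 3 by (auto intro!: derivative_eq_intros simp: field_simps power2_eq_square)
      ultimately show ?thesis by simp
    qed
    then show ?thesis
      by (rule has_field_derivative_transform_within_open[of _ _ _ "{0<..}"])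
         (use 3 in \<open>auto simp: flat_def\<close>)
  qed
qed

lemma Ck_flat_affine:
  fixes i :: "'n::finite"
  shows "Ck k (\<lambda>x::real^'n. flat m (c * x $ i + d))"
proof (induction k arbitrary: m)
  have D: "((\<lambda>x::real^'n. flat m (c * x $ i + d)) has_derivative
      (\<lambda>h. (flat (m + 2) (c * x $ i + d) - m * flat (m + 1) (c * x $ i + d)) * (c * h $ i))) (at x)" for x m
  proof -
    have "((\<lambda>x::real^'n. c * x $ i + d) has_derivative (\<lambda>h. c * h $ i)) (at x)"
      by (auto intro!: derivative_eq_intros bounded_linear.has_derivative[OF bounded_linear_vec_nth])
    from has_derivative_compose[OF this] flat_deriv[of m "c * x $ i + d"]
    show ?thesis unfolding has_field_derivative_def by blast
  qed
  {
    case 0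
    have "(\<lambda>x::real^'n. flat m (c * x $ i + d)) differentiable (at x)" for x
      using D by (rule differentiableI)
    then show ?case
      by (simp add: differentiable_imp_continuous_on differentiable_on_def)
  next
    case (Suc k)
    have "partial_deriv j (\<lambda>x::real^'n. flat m (c * x $ i + d)) =
      (\<lambda>x. (c * axis j 1 $ i) * flat (m + 2) (c * x $ i + d)
         + (- real m * c * axis j 1 $ i) * flat (m + 1) (c * x $ i + d))" for j
      by (rule ext, subst partial_deriv_eq[OF D]) (simp add: algebra_simps)
    moreover have "Ck k (\<lambda>x. (c * axis j 1 $ i) * flat (m + 2) (c * x $ i + d)
         + (- real m * c * axis j 1 $ i) * flat (m + 1) (c * x $ i + d))" for j
      by (intro Ck_add Ck_mult Ck_const Suc.IH)
    ultimately show ?case using differentiableI[OF D] by simp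
  }
qed

text \<open>The shift by \<open>- 1\<close> makes the function vanish within distance \<open>1 / n\<close> of the
  faces of the box.  Its closed support therefore lies inside the open box, so that it is a test
  function on \<open>\<Omega>\<close> even for boxes that touch the boundary of \<open>\<Omega>\<close>.\<close>

definition bump :: "real ^ 'n \<Rightarrow> real ^ 'n \<Rightarrow> nat \<Rightarrow> real ^ 'n \<Rightarrow> real" where
  "bump a b n x = (\<Prod>i\<in>UNIV. flat 0 (n * (x $ i - a $ i) - 1) * flat 0 (n * (b $ i - x $ i) - 1))"

lemma smooth_bump: "smooth (bump a b n)"
proof -
  have e: "n * (x $ i - a $ i) - 1 = real n * x $ i + (- real n * a $ i - 1)"
    "n * (b $ i - x $ i) - 1 = (- real n) * x $ i + (n * b $ i - 1)" for x i
    by (auto simp: algebra_simps)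
  show ?thesis
    unfolding smooth_def bump_def e by (intro allI Ck_prod Ck_mult Ck_flat_affine)
qed

lemma bump_support:
  assumes "n > 0" "bump a b n x \<noteq> 0"
  shows "x \<in> cbox (a + (\<chi> i. 1 / n)) (b - (\<chi> i. 1 / n))"
proof -
  have "1 / n \<le> x $ i - a $ i \<and> 1 / n \<le> b $ i - x $ i" for i
  proof -
    have "flat 0 (n * (x $ i - a $ i) - 1) * flat 0 (n * (b $ i - x $ i) - 1) \<noteq> 0"
      using assms(2) unfolding bump_def by (metis (no_types, lifting) finite prod_zero_iff UNIV_I)
    then show ?thesis using assms(1) by (auto simp: flat_def field_simps split: if_splits)
  qed
  then show ?thesis by (auto simp: mem_box_cart algebra_simps)
qed

lemma test_function_bump:
  assumes "box a b \<subseteq> \<Omega>" "n > 0"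
  shows "test_function \<Omega> (bump a b n)"
proof -
  let ?C = "cbox (a + (\<chi> i. 1 / n)) (b - (\<chi> i. 1 / n))"
  have cl: "closure {x. bump a b n x \<noteq> 0} \<subseteq> ?C"
    by (rule closure_minimal) (auto dest: bump_support[OF assms(2)])
  have "?C \<subseteq> box a b"
  proof
    fix x assume "x \<in> ?C"
    then have "a $ i + 1 / n \<le> x $ i" "x $ i \<le> b $ i - 1 / n" for i
      by (simp_all add: mem_box_cart)
    moreover have "1 / real n > 0" using assms(2) by simp
    ultimately have "a $ i < x $ i" "x $ i < b $ i" for i
      by (smt (verit))+
    then show "x \<in> box a b" by (simp add: mem_box_cart)
  qed
  with cl assms(1) have "closure {x. bump a b n x \<noteq> 0} \<subseteq> \<Omega>" by blast
  moreover have "compact (closure {x. bump a b n x \<noteq> 0})"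
    using cl by (meson bounded_cbox bounded_subset closed_closure compact_eq_bounded_closed)
  ultimately show ?thesis unfolding test_function_def using smooth_bump by blast
qed

lemma flat_0_bounds: "0 \<le> flat 0 t" "flat 0 t \<le> 1"
  by (auto simp: flat_def)

lemma bump_bounds: "0 \<le> bump a b n x" "bump a b n x \<le> 1"
  unfolding bump_def
  by (auto intro!: prod_nonneg prod_le_1 mult_nonneg_nonneg mult_le_one flat_0_bounds)

text \<open>For \<open>t > 0\<close> the argument tends to infinity, where \<open>exp (- 1 / s)\<close> tends to one; for
  \<open>t \<le> 0\<close> it is always negative.\<close>

lemma flat_0_limit:
  "(\<lambda>n. flat 0 (real n * t - 1)) \<longlonglongrightarrow> (if t > 0 then 1 else 0)"
proof (cases "t > 0")
  case True
  then have top: "filterlim (\<lambda>n. real n * t - 1) at_top sequentially"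
    by real_asymp
  have "(\<lambda>n. exp (- (1 / (real n * t - 1)))) \<longlonglongrightarrow> exp (- 0)"
    by (intro tendsto_intros tendsto_divide_0[OF tendsto_const] filterlim_at_top_imp_at_infinity top)
  then have "(\<lambda>n. exp (- (1 / (real n * t - 1)))) \<longlonglongrightarrow> 1" by simp
  moreover have "\<forall>\<^sub>F n in sequentially. exp (- (1 / (real n * t - 1))) = flat 0 (real n * t - 1)"
    using filterlim_at_top_dense[THEN iffD1, OF top, rule_format, of 0]
    by eventually_elim (simp add: flat_def)
  ultimately show ?thesis
    using True by (simp add: Lim_transform_eventually)
next
  case False
  then have "flat 0 (real n * t - 1) = 0" for n
    using mult_nonneg_nonpos[of "real n" t] by (simp add: flat_def)
  then show ?thesis using False by simp
qed

lemma bump_limit: "(\<lambda>n. bump a b n x) \<longlonglongrightarrow> indicator (box a b) x"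
proof -
  have "(\<lambda>n. bump a b n x) \<longlonglongrightarrow> (\<Prod>i\<in>UNIV. (if x $ i - a $ i > 0 then 1 else 0) * (if b $ i - x $ i > 0 then 1 else 0))"
    unfolding bump_def by (intro tendsto_prod tendsto_mult flat_0_limit)
  also have "(\<Prod>i\<in>UNIV. (if x $ i - a $ i > 0 then 1 else 0) * (if b $ i - x $ i > 0 then 1 else 0 :: real)) = indicator (box a b) x"
  proof (cases "x \<in> box a b")
    case False
    then obtain i where "\<not> (x $ i - a $ i > 0 \<and> b $ i - x $ i > 0)"
      by (auto simp: mem_box_cart)
    then have "(\<Prod>i\<in>UNIV. (if x $ i - a $ i > 0 then 1 else 0) * (if b $ i - x $ i > 0 then 1 else 0 :: real)) = 0"
      by (intro prod_zero) auto
    with False show ?thesis by (simp only: indicator_simps simp_thms)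
  qed (simp add: mem_box_cart)
  finally show ?thesis .
qed


section \<open>The fundamental lemma of the calculus of variations\<close>

text \<open>Dominated convergence along the bump functions, with \<open>\<bar>f\<bar>\<close> as the dominating function.\<close>

lemma integral_box_eq_0:
  fixes f :: "real ^ 'n \<Rightarrow> real"
  assumes f: "integrable lborel f"
    and orth: "\<And>\<phi>. test_function \<Omega> \<phi> \<Longrightarrow> (\<integral>x. f x * \<phi> x \<partial>lborel) = 0"
    and sub: "box a b \<subseteq> \<Omega>"
  shows "(\<integral>x\<in>box a b. f x \<partial>lborel) = 0"
proof -
  have [measurable]: "f \<in> borel_measurable borel"
    using f by auto
  have bm [measurable]: "bump a b n \<in> borel_measurable borel" for n
    using smooth_bump[of a b n] by (intro borel_measurable_continuous_onI smooth_continuous)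
  have lim: "(\<lambda>n. \<integral>x. f x * bump a b (Suc n) x \<partial>lborel) \<longlonglongrightarrow> (\<integral>x. f x * indicator (box a b) x \<partial>lborel)"
  proof (rule integral_dominated_convergence[where w = "\<lambda>x. \<bar>f x\<bar>"])
    show "AE x in lborel. (\<lambda>n. f x * bump a b (Suc n) x) \<longlonglongrightarrow> f x * indicator (box a b) x"
      by (intro AE_I2 tendsto_mult tendsto_const LIMSEQ_Suc bump_limit)
    show "AE x in lborel. norm (f x * bump a b (Suc n) x) \<le> \<bar>f x\<bar>" for n
      using bump_bounds[of a b "Suc n"] by (auto simp: abs_mult intro!: mult_left_le)
  qed (use f in auto)
  have "(\<integral>x. f x * bump a b (Suc n) x \<partial>lborel) = 0" for n
    by (intro orth test_function_bump[OF sub]) simp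
  then have "(\<integral>x. f x * indicator (box a b) x \<partial>lborel) = 0"
    using lim by (simp only: LIMSEQ_const_iff)
  then show ?thesis by (simp add: set_lebesgue_integral_def mult.commute)
qed

text \<open>The Borel sets \<open>A\<close> for which \<open>f\<close> has integral zero over \<open>A \<inter> box c d\<close> form a
  Dynkin system that contains all boxes, hence they are all the Borel sets.\<close>

lemma AE_eq_0_of_box_integrals:
  fixes f :: "'a::euclidean_space \<Rightarrow> real"
  assumes f: "integrable lborel f"
    and box0: "\<And>a b. box a b \<subseteq> box c d \<Longrightarrow> (\<integral>x\<in>box a b. f x \<partial>lborel) = 0"
  shows "AE x in lborel. x \<in> box c d \<longrightarrow> f x = 0"
proof -
  define g where "g x = indicator (box c d) x *\<^sub>R f x" for x
  have g: "integrable lborel g"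
    unfolding g_def by (intro integrable_mult_indicator f) auto
  have gset: "set_integrable lborel A g" if "A \<in> sets borel" for A
    unfolding set_integrable_def using that by (intro integrable_mult_indicator g) auto
  have gint: "(\<integral>x\<in>A. g x \<partial>lborel) = (\<integral>x\<in>A \<inter> box c d. f x \<partial>lborel)" for A
    unfolding g_def set_lebesgue_integral_def by (simp add: indicator_inter_arith mult.assoc)
  have "(\<integral>x\<in>A. g x \<partial>lborel) = 0" if A: "A \<in> sets borel" for A
  proof -
    have "Int_stable (range (\<lambda>(a, b). box a b :: 'a set))"
      by (auto simp: Int_stable_def box_Int_box)
    moreover have "range (\<lambda>(a, b). box a b :: 'a set) \<subseteq> Pow UNIV"
      by auto
    moreover have "A \<in> sigma_sets UNIV (range (\<lambda>(a, b). box a b))"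
      using A unfolding borel_eq_box by simp
    ultimately show ?thesis
    proof (induction rule: sigma_sets_induct_disjoint)
      case (basic A)
      then obtain a b where A: "A = box a b" by auto
      from box_Int_box[of a b c d] obtain a' b' where ab: "A \<inter> box c d = box a' b'"
        unfolding A by blast
      moreover have "box a' b' \<subseteq> box c d"
        unfolding ab[symmetric] by (rule inf_le2)
      ultimately show ?case
        unfolding gint by (simp add: box0)
    next
      case empty
      show ?case by (simp add: set_lebesgue_integral_def)
    next
      case (compl A)
      then have [measurable]: "A \<in> sets borel"
        by (simp add: borel_eq_box)
      have "(\<integral>x\<in>(UNIV - A) \<union> A. g x \<partial>lborel)
          = (\<integral>x\<in>UNIV - A. g x \<partial>lborel) + (\<integral>x\<in>A. g x \<partial>lborel)"
        by (intro set_integral_Un gset) auto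
      moreover have "(\<integral>x\<in>(UNIV - A) \<union> A. g x \<partial>lborel) = 0"
        using box0[of c d] by (simp add: gint)
      ultimately show ?case using compl by simp
    next
      case (union A)
      then have [measurable]: "\<And>i. A i \<in> sets borel"
        by (auto simp: borel_eq_box)
      have "(\<integral>x\<in>(\<Union>i. A i). g x \<partial>lborel) = (\<Sum>i. \<integral>x\<in>A i. g x \<partial>lborel)"
        using union(1) by (intro lebesgue_integral_countable_add gset) (auto simp: disjoint_family_on_def)
      then show ?case using union by simp
    qed
  qed
  then have "AE x in lborel. g x = 0"
    by (intro sigma_finite_measure.density_zero[OF lborel.sigma_finite_measure_axioms g]) simp
  then show ?thesis
    by eventually_elim (auto simp: g_def)
qed

text \<open>An open set is a countable union of open boxes, so it suffices to argue on each box.  The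
  Lebesgue measurable \<open>f\<close> is first replaced by a Borel function \<open>g\<close> that agrees with it
  almost everywhere, since the generation by boxes concerns Borel sets only.\<close>

lemma fundamental_lemma_calculus_of_variations:
  fixes f :: "real ^ 'n \<Rightarrow> real"
  assumes "open \<Omega>" and f: "integrable (lebesgue_on \<Omega>) f"
    and orth: "\<And>\<phi>. test_function \<Omega> \<phi> \<Longrightarrow> (\<integral>x. f x * \<phi> x \<partial>lebesgue_on \<Omega>) = 0"
  shows "AE x in lebesgue_on \<Omega>. f x = 0"
proof -
  have \<Omega>: "\<Omega> \<inter> space lebesgue \<in> sets lebesgue"
    using \<open>open \<Omega>\<close> by auto
  define f0 where "f0 x = indicator \<Omega> x *\<^sub>R f x" for x
  have f0: "integrable lebesgue f0"
    using f \<Omega> unfolding f0_def by (simp add: integrable_restrict_space)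
  obtain g where g [measurable]: "g \<in> borel_measurable lborel" and "AE x in lborel. f0 x = g x"
    using completion_ex_borel_measurable_real f0 by blast
  then have ae: "AE x in lebesgue. f0 x = g x"
    by (intro AE_completion)
  have g': "g \<in> borel_measurable lebesgue"
    by (rule measurable_completion[OF g])
  have gint: "integrable lborel g"
    using integrable_cong_AE_imp[OF f0 g'] ae integrable_completion[OF g] by (auto simp: eq_commute)
  have "(\<integral>x. g x * \<phi> x \<partial>lborel) = 0" if \<phi>: "test_function \<Omega> \<phi>" for \<phi>
  proof -
    have [measurable]: "\<phi> \<in> borel_measurable lborel"
      using \<phi> by (auto simp: test_function_def intro: borel_measurable_continuous_onI smooth_continuous)
    have \<phi>': "\<phi> \<in> borel_measurable lebesgue"
      by (rule measurable_completion) measurable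
    have "(\<integral>x. g x * \<phi> x \<partial>lborel) = (\<integral>x. g x * \<phi> x \<partial>lebesgue)"
      by (rule integral_completion[symmetric]) measurable
    also have "\<dots> = (\<integral>x. f0 x * \<phi> x \<partial>lebesgue)"
      by (rule integral_cong_AE) (use ae f0 g' \<phi>' in \<open>auto intro!: borel_measurable_times\<close>)
    also have "\<dots> = (\<integral>x. f x * \<phi> x \<partial>lebesgue_on \<Omega>)"
      by (simp add: integral_restrict_space[OF \<Omega>] f0_def mult.assoc)
    also have "\<dots> = 0" by (rule orth[OF \<phi>])
    finally show ?thesis .
  qed
  note box0 = integral_box_eq_0[OF gint this]
  obtain \<D> where \<D>: "countable \<D>" "\<D> \<subseteq> Pow \<Omega>" "\<And>X. X \<in> \<D> \<Longrightarrow> \<exists>a b. X = box a b" "\<Union>\<D> = \<Omega>"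
    using open_countable_Union_open_box[OF \<open>open \<Omega>\<close>] by blast
  have "AE x in lborel. x \<in> X \<longrightarrow> g x = 0" if "X \<in> \<D>" for X
  proof -
    obtain c d where X: "X = box c d" using \<D>(3) \<open>X \<in> \<D>\<close> by blast
    show ?thesis
      unfolding X
    proof (rule AE_eq_0_of_box_integrals[OF gint])
      fix a b :: "real ^ 'n" assume "box a b \<subseteq> box c d"
      then have "box a b \<subseteq> \<Omega>" using \<D>(2) \<open>X \<in> \<D>\<close> X by auto
      then show "(\<integral>x\<in>box a b. g x \<partial>lborel) = 0" by (rule box0[rotated])
    qed
  qed
  then have "AE x in lborel. \<forall>X\<in>\<D>. x \<in> X \<longrightarrow> g x = 0"
    using \<D>(1) by (intro AE_ball_countable'[rule_format])
  then have "AE x in lborel. x \<in> \<Omega> \<longrightarrow> g x = 0"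
    by eventually_elim (use \<D>(4) in blast)
  then have "AE x in lebesgue. x \<in> \<Omega> \<longrightarrow> g x = 0"
    by (rule AE_completion)
  then have "AE x in lebesgue. x \<in> \<Omega> \<longrightarrow> f x = 0"
    using ae by eventually_elim (auto simp: f0_def)
  then show ?thesis by (simp add: AE_restrict_space_iff[OF \<Omega>])
qed

section \<open>Square-integrable functions\<close>

lemma L2_inner_integrable:
  assumes "f \<in> L2 M" "g \<in> L2 M"
  shows "integrable M (\<lambda>x. f x \<bullet> g x)"
proof (rule Bochner_Integration.integrable_bound)
  show "integrable M (\<lambda>x. (norm (f x))\<^sup>2 + (norm (g x))\<^sup>2)"
    using assms by (auto simp: L2_def)
  show "(\<lambda>x. f x \<bullet> g x) \<in> borel_measurable M"
    using assms by (auto simp: L2_def)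
  have "\<bar>f x \<bullet> g x\<bar> \<le> (norm (f x))\<^sup>2 + (norm (g x))\<^sup>2" for x
  proof -
    have "\<bar>f x \<bullet> g x\<bar> \<le> norm (f x) * norm (g x)" by (rule Cauchy_Schwarz_ineq2)
    moreover have "2 * (norm (f x) * norm (g x)) \<le> (norm (f x))\<^sup>2 + (norm (g x))\<^sup>2"
      using sum_squares_bound[of "norm (f x)" "norm (g x)"] by simp
    moreover have "0 \<le> norm (f x) * norm (g x)" by simp
    ultimately show ?thesis by linarith
  qed
  then show "AE x in M. norm (f x \<bullet> g x) \<le> norm ((norm (f x))\<^sup>2 + (norm (g x))\<^sup>2)"
    by auto
qed

lemma l2_inner_self: "l2_inner M f f = (l2_norm M f)\<^sup>2"
  by (simp add: l2_norm_def l2_inner_def)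

lemma l2_norm_nonneg: "0 \<le> l2_norm M f"
  by (simp add: l2_norm_def l2_inner_def)

lemma l2_norm_eq_0:
  assumes "f \<in> L2 M" "l2_norm M f = 0"
  shows "AE x in M. f x = 0"
proof -
  have "(\<integral>x. f x \<bullet> f x \<partial>M) = 0"
    using assms(2) by (simp add: l2_norm_def l2_inner_def)
  then have "AE x in M. f x \<bullet> f x = 0"
    by (subst (asm) integral_nonneg_eq_0_iff_AE[OF L2_inner_integrable[OF assms(1,1)]]) auto
  then show ?thesis by simp
qed

lemma l2_inner_eq_0:
  assumes "f \<in> L2 M" "l2_norm M f = 0"
  shows "l2_inner M f g = 0"
proof -
  have "AE x in M. f x \<bullet> g x = 0"
    using l2_norm_eq_0[OF assms] by eventually_elim simp
  then show ?thesis
    unfolding l2_inner_def by (rule integral_eq_zero_AE)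
qed

lemma l2_inner_commute: "l2_inner M f g = l2_inner M g f"
  by (simp add: l2_inner_def inner_commute)

lemma l2_Cauchy_Schwarz:
  assumes f: "f \<in> L2 M" and g: "g \<in> L2 M"
  shows "l2_inner M f g \<le> l2_norm M f * l2_norm M g"
proof -
  note int = L2_inner_integrable[OF f f] L2_inner_integrable[OF f g] L2_inner_integrable[OF g g]
  \<comment> \<open>nonnegativity of the square of \<open>\<parallel>s f - t g\<parallel>\<close>, used below with \<open>s = \<parallel>g\<parallel>\<close> and \<open>t = \<parallel>f\<parallel>\<close>\<close>
  have quad: "2 * s * t * l2_inner M f g \<le> s\<^sup>2 * (l2_norm M f)\<^sup>2 + t\<^sup>2 * (l2_norm M g)\<^sup>2" for s t
  proof -
    have "0 \<le> (\<integral>x. (s *\<^sub>R f x - t *\<^sub>R g x) \<bullet> (s *\<^sub>R f x - t *\<^sub>R g x) \<partial>M)"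
      by (rule integral_nonneg_AE) auto
    also have "\<dots> = (\<integral>x. s\<^sup>2 * (f x \<bullet> f x) - 2 * s * t * (f x \<bullet> g x) + t\<^sup>2 * (g x \<bullet> g x) \<partial>M)"
      by (simp add: inner_diff inner_commute algebra_simps power2_eq_square)
    also have "\<dots> = s\<^sup>2 * l2_inner M f f - 2 * s * t * l2_inner M f g + t\<^sup>2 * l2_inner M g g"
      using int by (simp add: l2_inner_def)
    finally show ?thesis by (simp add: l2_inner_self)
  qed
  let ?a = "l2_norm M f" and ?b = "l2_norm M g"
  show ?thesis
  proof (cases "?a * ?b = 0")
    case False
    then have pos: "?a > 0" "?b > 0"
      using l2_norm_nonneg[of M f] l2_norm_nonneg[of M g] by auto
    have "2 * (?a * ?b) * l2_inner M f g \<le> 2 * (?a * ?b) * (?a * ?b)"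
      using quad[of ?b ?a] by (simp add: algebra_simps power2_eq_square)
    then show ?thesis
      using pos by (metis mult_le_cancel_left_pos mult_pos_pos zero_less_numeral)
  next
    case True
    then have "l2_inner M f g = 0"
      using l2_inner_eq_0[OF f, of g] l2_inner_eq_0[OF g, of f] l2_inner_commute[of M f g] by auto
    with True show ?thesis by (metis order_refl)
  qed
qed

section \<open>Zero and constant functions in the finite element spaces\<close>

lemma zero_in_L2: "(\<lambda>_. 0) \<in> L2 M"
  by (simp add: L2_def)

lemma const_in_L2:
  "finite_measure M \<Longrightarrow> (\<lambda>_. c) \<in> L2 M"
  by (simp add: L2_def finite_measure.integrable_const)

text \<open>The components of the chosen weak gradient are orthogonal to all test functions.  They are
  integrable, as products of a square-integrable function with a constant one on a set of finite
  measure, and so the fundamental lemma applies.\<close>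

lemma weak_grad_0:
  fixes \<Omega> :: "(real ^ 'n) set"
  assumes "open \<Omega>" "bounded \<Omega>"
  shows "AE x in lebesgue_on \<Omega>. weak_grad \<Omega> (\<lambda>_. 0) x = 0"
proof -
  let ?G = "weak_grad \<Omega> (\<lambda>_. 0)"
  have "(\<lambda>_. 0) \<in> L2 (lebesgue_on \<Omega>) \<and> is_weak_grad \<Omega> (\<lambda>_. 0) (\<lambda>_. 0)"
    by (simp add: is_weak_grad_def zero_in_L2)
  then have G: "?G \<in> L2 (lebesgue_on \<Omega>)" and wg: "is_weak_grad \<Omega> (\<lambda>_. 0) ?G"
    unfolding weak_grad_def by (smt (verit, best) someI_ex)+
  have fin: "finite_measure (lebesgue_on \<Omega>)"
    by (intro finite_measure_lebesgue_on bounded_set_imp_lmeasurable assms) (use assms in auto)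
  have "AE x in lebesgue_on \<Omega>. ?G x $ i $ j = 0" for i j
  proof (rule fundamental_lemma_calculus_of_variations[OF \<open>open \<Omega>\<close>])
    have "?G x $ i $ j = ?G x \<bullet> axis i (axis j 1)" for x
      by (simp add: inner_axis)
    then show "integrable (lebesgue_on \<Omega>) (\<lambda>x. ?G x $ i $ j)"
      using L2_inner_integrable[OF G const_in_L2[OF fin]] by simp
    show "(\<integral>x. ?G x $ i $ j * \<phi> x \<partial>lebesgue_on \<Omega>) = 0" if "test_function \<Omega> \<phi>" for \<phi>
      using wg that by (simp add: is_weak_grad_def)
  qed
  then have "AE x in lebesgue_on \<Omega>. \<forall>i j. ?G x $ i $ j = 0"
    by (simp add: AE_all_countable)
  then show ?thesis
    by eventually_elim (simp add: vec_eq_iff)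
qed

lemma l2_norm_cong_0: "AE x in M. f x = 0 \<Longrightarrow> l2_norm M f = 0"
  unfolding l2_norm_def l2_inner_def by (simp add: integral_eq_zero_AE)

lemma V_norm_0:
  assumes "open \<Omega>" "bounded \<Omega>"
  shows "V_norm \<Omega> (\<lambda>_. 0) = 0"
proof -
  have "AE x in lebesgue_on \<Omega>. strain \<Omega> (\<lambda>_. 0) x = 0"
    using weak_grad_0[OF assms] by eventually_elim (simp add: strain_def transpose_def vec_eq_iff)
  then show ?thesis
    by (simp add: V_norm_def l2_norm_cong_0)
qed

lemma zero_in_H1: "(\<lambda>_. 0) \<in> H1 \<Omega>"
  by (auto simp: H1_def is_weak_grad_def zero_in_L2 intro!: bexI[of _ "\<lambda>_. 0"])

text \<open>The zero function is approximated by the constant sequence of zero functions; what has to be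
  shown is that its \<open>H\<^sup>1\<close> norm, which involves a chosen weak gradient, is zero.\<close>

lemma zero_has_trace_0:
  assumes "open \<Omega>" "bounded \<Omega>"
  shows "has_trace \<Omega> (\<lambda>_. 0) (\<lambda>_. 0)"
proof -
  have "H1_norm \<Omega> (\<lambda>_. 0) = 0"
    by (simp add: H1_norm_def l2_norm_cong_0 weak_grad_0[OF assms])
  then show ?thesis
    unfolding has_trace_def
    by (intro conjI zero_in_H1 zero_in_L2 exI[of _ "\<lambda>_ _. 0"])
       (simp_all add: smooth_def Ck_const l2_norm_cong_0)
qed

lemma const_in_tensor_poly: "(\<lambda>_. c) \<in> (tensor_poly k :: (real ^ 'n \<Rightarrow> real) set)"
proof -
  let ?A = "{\<alpha> :: 'n \<Rightarrow> nat. \<forall>i. \<alpha> i \<le> k}"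
  have A: "?A = (UNIV \<rightarrow>\<^sub>E {..k})" by auto
  have "finite ?A"
    unfolding A by (intro finite_PiE) auto
  have "(\<Sum>\<alpha>\<in>?A. (if \<alpha> = (\<lambda>_. 0) then c else 0) * (\<Prod>i\<in>UNIV. x $ i ^ \<alpha> i)) = c" for x :: "real ^ 'n"
  proof -
    have "(\<Sum>\<alpha>\<in>?A. (if \<alpha> = (\<lambda>_. 0) then c else 0) * (\<Prod>i\<in>UNIV. x $ i ^ \<alpha> i))
        = (\<Sum>\<alpha>\<in>?A. if \<alpha> = (\<lambda>_. 0) then c else 0)"
      by (intro sum.cong) auto
    also have "\<dots> = c" using \<open>finite ?A\<close> by (simp add: sum.delta)
    finally show ?thesis .
  qed
  then show ?thesis
    unfolding tensor_poly_def by (auto intro!: exI[of _ "\<lambda>\<alpha>. if \<alpha> = (\<lambda>_. 0) then c else 0"])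
qed

lemma zero_in_V_hp:
  assumes "open \<Omega>" "bounded \<Omega>"
  shows "(\<lambda>_. 0) \<in> V_hp \<Omega> \<Gamma>\<^sub>D \<T> F p"
proof -
  have "(\<lambda>_. 0) \<in> V_space \<Omega> \<Gamma>\<^sub>D"
    unfolding V_space_def using zero_has_trace_0[OF assms] zero_in_H1 by force
  then show ?thesis
    unfolding V_hp_def by (auto intro!: exI[of _ "\<lambda>_. 0"] const_in_tensor_poly)
qed

lemma const_in_Q_hp:
  assumes "open \<Omega>" "bounded \<Omega>" "C \<in> sym_tracefree"
  shows "(\<lambda>_. C) \<in> Q_hp \<Omega> \<T> F p"
proof -
  have "finite_measure (lebesgue_on \<Omega>)"
    by (intro finite_measure_lebesgue_on bounded_set_imp_lmeasurable assms) (use assms in auto)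
  then show ?thesis
    unfolding Q_hp_def Q_space_def using assms(3)
    by (auto intro!: const_in_L2 exI[of _ "\<lambda>_. C"] const_in_tensor_poly)
qed

text \<open>In dimension two or more there is room for a symmetric pair of off-diagonal entries.\<close>

lemma sym_tracefree_nontrivial:
  assumes "CARD('n) \<ge> 2"
  obtains C :: "real ^ 'n ^ 'n" where "C \<in> sym_tracefree" "C \<noteq> 0"
proof -
  obtain a b :: 'n where ab: "a \<noteq> b"
    using assms by (metis (full_types) card_le_Suc0_iff_eq finite not_less_eq_eq numeral_2_eq_2 UNIV_I)
  let ?C = "(\<chi> i j. if {i, j} = {a, b} then 1 else 0) :: real ^ 'n ^ 'n"
  have "transpose ?C = ?C"
    by (simp add: transpose_def vec_eq_iff insert_commute)
  moreover have "trace ?C = 0"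
    using ab by (auto simp: trace_def doubleton_eq_iff intro!: sum.neutral)
  moreover have "?C $ a $ b = 1" by simp
  then have "?C \<noteq> 0" by (metis zero_index zero_neq_one)
  ultimately show ?thesis using that[of ?C] by (simp add: sym_tracefree_def)
qed

lemma l2_norm_const_pos:
  fixes \<Omega> :: "'a::euclidean_space set"
  assumes "open \<Omega>" "bounded \<Omega>" "\<Omega> \<noteq> {}" "c \<noteq> 0"
  shows "l2_norm (lebesgue_on \<Omega>) (\<lambda>_. c) > 0"
proof -
  have m: "\<Omega> \<in> lmeasurable"
    using assms by (intro bounded_set_imp_lmeasurable) auto
  have "measure lebesgue \<Omega> > 0"
    using open_not_negligible[OF assms(1,3)] m by (simp add: zero_less_measure_iff negligible_iff_measure)
  then show ?thesis
    using assms(4) m by (simp add: l2_norm_def l2_inner_def measure_restrict_space)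
qed

lemma VQ_norm_0_left:
  assumes "open \<Omega>" "bounded \<Omega>"
  shows "VQ_norm \<Omega> (\<lambda>_. 0, q) = l2_norm (lebesgue_on \<Omega>) q"
  by (simp add: VQ_norm_def V_norm_0[OF assms] l2_norm_nonneg)

lemma l2_norm_le_VQ_norm: "l2_norm (lebesgue_on \<Omega>) q \<le> VQ_norm \<Omega> (v, q)"
  unfolding VQ_norm_def by (simp add: real_le_rsqrt)

lemma Q_hp_subset_L2: "Q_hp \<Omega> \<T> F p \<subseteq> L2 (lebesgue_on \<Omega>)"
  by (auto simp: Q_hp_def Q_space_def)


section \<open>The supremum\<close>

theorem lemma4:
  fixes \<Omega> \<Gamma>\<^sub>D :: "(real ^ 'n) set"
    and \<T> :: "(real ^ 'n) set set"
    and F :: "(real ^ 'n) set \<Rightarrow> real ^ 'n \<Rightarrow> real ^ 'n"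
    and p :: "(real ^ 'n) set \<Rightarrow> nat"
    and \<kappa> \<kappa>' :: real
    and \<mu> :: "real ^ 'n \<Rightarrow> real ^ 'n ^ 'n"
  assumes "CARD('n) = 2 \<or> CARD('n) = 3"
    and "polyhedral_domain \<Omega>" and "lipschitz_boundary \<Omega>"
    and "\<Gamma>\<^sub>D \<subseteq> frontier \<Omega>" and "\<Gamma>\<^sub>D \<in> sets (surface_measure \<Omega>)"
    and "emeasure (surface_measure \<Omega>) \<Gamma>\<^sub>D > 0"
    and "fe_mesh \<Omega> \<T> F" and "locally_quasi_uniform \<kappa> \<T>"
    and "\<forall>T\<in>\<T>. p T \<ge> 1" and "comparable_degrees \<kappa>' \<T> p"
    and "\<forall>T\<in>\<T>. p T \<ge> 2 \<longrightarrow> jacobian_det (F T) \<in> tensor_poly 1"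
    and "\<mu> \<in> Q_hp \<Omega> \<T> F p"
  shows "(SUP (v, q) \<in> {(v, q). v \<in> V_hp \<Omega> \<Gamma>\<^sub>D \<T> F p \<and> q \<in> Q_hp \<Omega> \<T> F p \<and> VQ_norm \<Omega> (v, q) \<noteq> 0}.
            ereal (l2_inner (lebesgue_on \<Omega>) \<mu> q / VQ_norm \<Omega> (v, q)))
         = ereal (l2_norm (lebesgue_on \<Omega>) \<mu>)"
proof -
  let ?M = "lebesgue_on \<Omega>"
  let ?I = "{(v, q). v \<in> V_hp \<Omega> \<Gamma>\<^sub>D \<T> F p \<and> q \<in> Q_hp \<Omega> \<T> F p \<and> VQ_norm \<Omega> (v, q) \<noteq> 0}"
  have \<Omega>: "open \<Omega>" "bounded \<Omega>" "\<Omega> \<noteq> {}"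
    using assms(2) by (auto simp: polyhedral_domain_def)
  have \<mu>: "\<mu> \<in> L2 ?M"
    using assms(12) Q_hp_subset_L2 by blast
  have upper: "l2_inner ?M \<mu> q / VQ_norm \<Omega> (v, q) \<le> l2_norm ?M \<mu>" if "(v, q) \<in> ?I" for v q
  proof -
    have q: "q \<in> L2 ?M" "VQ_norm \<Omega> (v, q) \<noteq> 0"
      using that Q_hp_subset_L2[of \<Omega> \<T> F p] by auto
    then have "VQ_norm \<Omega> (v, q) > 0"
      using l2_norm_le_VQ_norm[of \<Omega> q v] l2_norm_nonneg[of ?M q] by linarith
    moreover have "l2_inner ?M \<mu> q \<le> l2_norm ?M \<mu> * VQ_norm \<Omega> (v, q)"
      using l2_Cauchy_Schwarz[OF \<mu> q(1)] mult_left_mono[OF l2_norm_le_VQ_norm l2_norm_nonneg]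
      by (rule order_trans)
    ultimately show ?thesis by (simp add: divide_le_eq)
  qed
  obtain q where q: "q \<in> Q_hp \<Omega> \<T> F p" "l2_norm ?M q > 0"
      and extremal: "l2_inner ?M \<mu> q = l2_norm ?M \<mu> * l2_norm ?M q"
  proof (cases "l2_norm ?M \<mu> = 0")
    case True
    have "CARD('n) \<ge> 2" using assms(1) by auto
    then obtain C :: "real ^ 'n ^ 'n" where C: "C \<in> sym_tracefree" "C \<noteq> 0"
      by (rule sym_tracefree_nontrivial)
    show ?thesis
      using that[of "\<lambda>_. C"] const_in_Q_hp[OF \<Omega>(1,2) C(1)] l2_norm_const_pos[OF \<Omega> C(2)]
        l2_inner_eq_0[OF \<mu> True] True by simp
  next
    case False
    then show ?thesis
      using that[of \<mu>] assms(12) l2_norm_nonneg[of ?M \<mu>]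
      by (simp add: l2_inner_self power2_eq_square)
  qed
  have "(\<lambda>_. 0, q) \<in> ?I"
    using q zero_in_V_hp[OF \<Omega>(1,2)] by (simp add: VQ_norm_0_left[OF \<Omega>(1,2)])
  moreover have "l2_inner ?M \<mu> q / VQ_norm \<Omega> (\<lambda>_. 0, q) = l2_norm ?M \<mu>"
    using extremal q(2) by (simp add: VQ_norm_0_left[OF \<Omega>(1,2)])
  ultimately show ?thesis
    by (intro antisym SUP_least SUP_upper2[where i = "(\<lambda>_. 0, q)"]) (auto simp: upper)
qed

end
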